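(* For every $\phi\in\mathcal L_{\mathsf{Ldm}}$ and every label $x$: if $\phi$ is valid (globally true on every $\mathsf{Tstit}$-model), then the labelled sequent $x:\phi$ is derivable in $\mathsf{G3Ldm}$.
   Context: Fix a finite set of agents $Ag=\{1,\dots,n\}$ and a countable set $Var$ of propositional variables. $\mathcal{L}_{\mathsf{Ldm}}$ (negation normal form): $\phi ::= p \mid \overline{p} \mid \phi\wedge\phi \mid \phi\vee\phi \mid \Box\phi \mid \Diamond\phi \mid [i]\phi \mid \langle i\rangle\phi$, $p\in Var$, $i\in Ag$. A $\mathsf{Tstit}$-model is $(W,\mathcal{R}_\Box,\{\mathcal{R}_i\}_{i\in Ag},\mathcal{R}_{Ag},\mathcal{R}_{\mathsf G},\mathcal{R}_{\mathsf H},V)$ with $W\ne\emptyset$, $V:Var\to\mathcal P(W)$, $\mathcal{R}_\Box,\mathcal{R}_i,\mathcal{R}_{Ag}$ equivalence relations on $W$, and (writing $\mathcal R(w)=\{v:(w,v)\in\mathcal R\}$): (C1) $\mathcal{R}_i\subseteq\mathcal{R}_\Box$; (C2) if $u_1,\dots,u_n$ are pairwise $\mathcal R_\Box$-related then $\bigcap_i\mathcal{R}_i(u_i)\ne\emptyset$; (C3) $\mathcal{R}_{Ag}(w)=\bigcap_i\mathcal{R}_i(w)$; $\mathcal{R}_{\mathsf G}$ transitive and serial, $\mathcal{R}_{\mathsf H}$ its converse; (C4) if $\mathcal{R}_{\mathsf G}wu,\mathcal{R}_{\mathsf G}wv$ then $\mathcal{R}_{\mathsf G}uv$ or $u=v$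 or $\mathcal{R}_{\mathsf G}vu$; (C5) same for $\mathcal{R}_{\mathsf H}$; (C6) $\mathcal{R}_{\mathsf G}\circ\mathcal{R}_\Box\subseteq\mathcal{R}_{Ag}\circ\mathcal{R}_{\mathsf G}$; (C7) $u\in\mathcal{R}_\Box(w)$ implies $u\notin\mathcal{R}_{\mathsf G}(w)$. Satisfaction: $w\models p$ iff $w\in V(p)$; $w\models\overline p$ iff $w\notin V(p)$; $\wedge,\vee$ classical; $\Box$/$\Diamond$ universal/existential over $\mathcal R_\Box(w)$; $[i]$/$\langle i\rangle$ over $\mathcal R_i(w)$. $\phi$ is globally true on $M$ if it holds at every world of $M$. Labelled sequents: multisets built by $\Gamma ::= x:\phi \mid \Gamma,\Gamma \mid \mathcal{R}_\alpha xy,\Gamma$, labels from a countable set, $\phi\in\mathcal L_{\mathsf{Ldm}}$, $\alpha\in\{\Box\}\cup Ag$. Rules of $\mathsf{G3Ldm}$: (id) $\Gamma,w:p,w:\overline p$ is an axiom; ($\wedge$) from $\Gamma,w:\phi$ and $\Gamma,w:\psi$ infer $\Gamma,w:\phi\wedge\psi$; ($\vee$) from $\Gamma,w:\phi,w:\psi$ infer $\Gamma,w:\phi\vee\psi$; ($\Box$) from $\Gamma,\mathcal R_\Box wv,v:\phi$ infer $\Gamma,w:\Box\phi$; ($\Diamond$) from $\Gamma,\mathcal R_\Box wu,w:\Diamond\phi,u:\phi$ infer $\Gamma,\mathcal R_\Box wu,w:\Diamond\phi$; ($[i]$) from $\Gamma,\mathcal R_iwv,v:\phi$ infer $\Gamma,w:[i]\phi$;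 ($\langle i\rangle$) from $\Gamma,\mathcal R_iwu,w:\langle i\rangle\phi,u:\phi$ infer $\Gamma,\mathcal R_iwu,w:\langle i\rangle\phi$; ($\mathsf{refl}_\Box$) from $\mathcal R_\Box ww,\Gamma$ infer $\Gamma$; ($\mathsf{refl}_{[i]}$) from $\mathcal R_iww,\Gamma$ infer $\Gamma$; ($\mathsf{IOA}$) from $\mathcal R_\Box wu_1,\dots,\mathcal R_\Box wu_n,\mathcal R_1u_1v,\dots,\mathcal R_nu_nv,\Gamma$ infer $\mathcal R_\Box wu_1,\dots,\mathcal R_\Box wu_n,\Gamma$; ($\mathsf{eucl}_\Box$) from $\mathcal R_\Box wu,\mathcal R_\Box wv,\mathcal R_\Box uv,\Gamma$ infer $\mathcal R_\Box wu,\mathcal R_\Box wv,\Gamma$; ($\mathsf{br}_{[i]}$) from $\mathcal R_\Box wu,\mathcal R_iwu,\Gamma$ infer $\mathcal R_iwu,\Gamma$; ($\mathsf{eucl}_{[i]}$) from $\mathcal R_iwu,\mathcal R_iwv,\mathcal R_iuv,\Gamma$ infer $\mathcal R_iwu,\mathcal R_iwv,\Gamma$. In ($\Box$), ($[i]$), ($\mathsf{IOA}$) the label $v$ must not occur in the conclusion. The calculus also contains, for each rule where a substitution of labels duplicates active relational atoms, the instance with the duplicates contracted. *)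

theory Defs
  imports "HOL-Library.Countable" "HOL-Library.Multiset" "HOL-Library.Infinite_Typeclass"
begin

section \<open>The language\<close>

text \<open>The set of agents is (the universe of) a finite type \<^typ>\<open>'ag\<close>, whose number of elements is an
  arbitrary \<open>n \<ge> 1\<close>; the set of propositional variables is a countable type \<^typ>\<open>'p\<close>.
  Formulas are in negation normal form: negation occurs only in the literals \<open>Neg p\<close>.\<close>

datatype ('p, 'ag) fml =
    Pos 'p
  | Neg 'p
  | And "('p, 'ag) fml" "('p, 'ag) fml"
  | Or "('p, 'ag) fml" "('p, 'ag) fml"
  | Box "('p, 'ag) fml"
  | Dia "('p, 'ag) fml"
  | Stit 'ag "('p, 'ag) fml"
  | CoStit 'ag "('p, 'ag) fml"


section \<open>Temporal STIT models\<close>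

record ('w, 'p, 'ag) frame =
  worlds :: "'w set"
  RBox :: "'w rel"
  RAgt :: "'ag \<Rightarrow> 'w rel"
  RAg :: "'w rel"
  RG :: "'w rel"
  RH :: "'w rel"
  Val :: "'p \<Rightarrow> 'w set"

text \<open>Composition of relations reads from left to right, as does \<^term>\<open>(O)\<close>: in \<open>C6\<close>, whenever
  \<open>w R\<^sub>G v\<close> and \<open>v R\<^sub>\<box> u\<close>, there is a \<open>z\<close> with \<open>w R\<^sub>A\<^sub>g z\<close> and \<open>z R\<^sub>G u\<close>.\<close>

locale tstit_model =
  fixes M :: "('w, 'p::countable, 'ag::finite) frame"
  assumes worlds_nonempty: "worlds M \<noteq> {}"
    and Val_worlds: "\<And>p. Val M p \<subseteq> worlds M"
    and equiv_RBox: "equiv (worlds M) (RBox M)"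
    and equiv_RAgt: "\<And>i. equiv (worlds M) (RAgt M i)"
    and equiv_RAg: "equiv (worlds M) (RAg M)"
    and C1: "\<And>i. RAgt M i \<subseteq> RBox M"
    and C2: "\<And>u. \<lbrakk>\<And>i. u i \<in> worlds M; \<And>i j. (u i, u j) \<in> RBox M\<rbrakk>
               \<Longrightarrow> (\<Inter>i. RAgt M i `` {u i}) \<noteq> {}"
    and C3: "\<And>w. w \<in> worlds M \<Longrightarrow> RAg M `` {w} = (\<Inter>i. RAgt M i `` {w})"
    and RG_worlds: "RG M \<subseteq> worlds M \<times> worlds M"
    and RG_trans: "trans (RG M)"
    and RG_serial: "\<And>w. w \<in> worlds M \<Longrightarrow> \<exists>v. (w, v) \<in> RG M"
    and RH_converse: "RH M = (RG M)\<inverse>"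
    and C4: "\<And>w u v. \<lbrakk>(w, u) \<in> RG M; (w, v) \<in> RG M\<rbrakk>
               \<Longrightarrow> (u, v) \<in> RG M \<or> u = v \<or> (v, u) \<in> RG M"
    and C5: "\<And>w u v. \<lbrakk>(w, u) \<in> RH M; (w, v) \<in> RH M\<rbrakk>
               \<Longrightarrow> (u, v) \<in> RH M \<or> u = v \<or> (v, u) \<in> RH M"
    and C6: "RG M O RBox M \<subseteq> RAg M O RG M"
    and C7: "\<And>w u. u \<in> RBox M `` {w} \<Longrightarrow> u \<notin> RG M `` {w}"

text \<open>There are no finite models, so a type of worlds must be infinite to carry a model at all.\<close>

lemma (in tstit_model) infinite_worlds: "infinite (worlds M)"
proof
  assume fin: "finite (worlds M)"
  have "(w, w) \<notin> RG M" for w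
    using C7[of w w] RG_worlds equiv_RBox by (auto simp: equiv_def refl_on_def)
  then have "acyclic (RG M)"
    using RG_trans by (simp add: acyclic_def trancl_id)
  moreover have "finite (RG M)"
    using fin RG_worlds by (meson finite_SigmaI finite_subset)
  ultimately have "wf ((RG M)\<inverse>)"
    by (simp add: finite_acyclic_wf_converse)
  then obtain z where z: "z \<in> worlds M" "\<And>y. (y, z) \<in> (RG M)\<inverse> \<Longrightarrow> y \<notin> worlds M"
    using worlds_nonempty by (metis ex_in_conv wfE_min)
  then show False
    using RG_serial[of z] RG_worlds by blast
qed

primrec sat :: "('w, 'p, 'ag) frame \<Rightarrow> 'w \<Rightarrow> ('p, 'ag) fml \<Rightarrow> bool" where
  "sat M w (Pos p) \<longleftrightarrow> w \<in> Val M p"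
| "sat M w (Neg p) \<longleftrightarrow> w \<notin> Val M p"
| "sat M w (And \<phi> \<psi>) \<longleftrightarrow> sat M w \<phi> \<and> sat M w \<psi>"
| "sat M w (Or \<phi> \<psi>) \<longleftrightarrow> sat M w \<phi> \<or> sat M w \<psi>"
| "sat M w (Box \<phi>) \<longleftrightarrow> (\<forall>u \<in> RBox M `` {w}. sat M u \<phi>)"
| "sat M w (Dia \<phi>) \<longleftrightarrow> (\<exists>u \<in> RBox M `` {w}. sat M u \<phi>)"
| "sat M w (Stit i \<phi>) \<longleftrightarrow> (\<forall>u \<in> RAgt M i `` {w}. sat M u \<phi>)"
| "sat M w (CoStit i \<phi>) \<longleftrightarrow> (\<exists>u \<in> RAgt M i `` {w}. sat M u \<phi>)"

definition globally_true :: "('w, 'p, 'ag) frame \<Rightarrow> ('p, 'ag) fml \<Rightarrow> bool" where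
  "globally_true M \<phi> \<longleftrightarrow> (\<forall>w \<in> worlds M. sat M w \<phi>)"

text \<open>Validity over all models whose worlds are drawn from the type \<^typ>\<open>'w\<close>. A definition cannot
  quantify over types, so the type is a parameter; statements about validity should leave it
  arbitrary. It has to be infinite, since otherwise every formula is vacuously valid.\<close>

definition valid :: "'w::infinite itself \<Rightarrow> ('p::countable, 'ag::finite) fml \<Rightarrow> bool" where
  "valid _ \<phi> \<longleftrightarrow> (\<forall>M :: ('w, 'p, 'ag) frame. tstit_model M \<longrightarrow> globally_true M \<phi>)"


section \<open>The labelled calculus\<close>

type_synonym label = nat

datatype 'ag index = Settled | Agent 'ag

text \<open>\<open>Lab x \<phi>\<close> is the labelled formula \<open>x : \<phi>\<close>. \<open>Rel Settled x y\<close> and \<open>Rel (Agent i) x y\<close> are the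
  relational atoms \<open>R\<^sub>\<box> x y\<close> and \<open>R\<^sub>i x y\<close>.\<close>

datatype ('p, 'ag) item =
    Lab label "('p, 'ag) fml"
  | Rel "'ag index" label label

type_synonym ('p, 'ag) sequent = "('p, 'ag) item multiset"

fun item_labels :: "('p, 'ag) item \<Rightarrow> label set" where
  "item_labels (Lab x \<phi>) = {x}"
| "item_labels (Rel \<alpha> x y) = {x, y}"

definition labels :: "('p, 'ag) sequent \<Rightarrow> label set" where
  "labels \<Gamma> = (\<Union>a \<in> set_mset \<Gamma>. item_labels a)"

text \<open>The rules suffixed \<open>_ctr\<close> are the instances in which a substitution of labels has made some
  active relational atoms coincide and the duplicates are contracted: \<open>u = v\<close> in the two
  Euclidean rules (identifying \<open>w\<close> and \<open>u\<close> as well only yields instances with equal premise and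
  conclusion), and coinciding labels among the \<open>u i\<close> in \<open>IOA\<close>. In \<open>IOA_ctr\<close> the active atoms
  \<open>R\<^sub>\<box> w (u i)\<close> occur once each; an instance contracting only some of the duplicates is obtained
  by putting the remaining copies into \<open>\<Gamma>\<close>.

  Every sequent derivable by these rules contains a labelled formula, as the axioms do.\<close>

inductive G3Ldm :: "('p, 'ag::finite) sequent \<Rightarrow> bool" where
  id: "G3Ldm (\<Gamma> + {#Lab w (Pos p), Lab w (Neg p)#})"
| And: "G3Ldm (\<Gamma> + {#Lab w \<phi>#}) \<Longrightarrow> G3Ldm (\<Gamma> + {#Lab w \<psi>#})
    \<Longrightarrow> G3Ldm (\<Gamma> + {#Lab w (And \<phi> \<psi>)#})"
| Or: "G3Ldm (\<Gamma> + {#Lab w \<phi>, Lab w \<psi>#}) \<Longrightarrow> G3Ldm (\<Gamma> + {#Lab w (Or \<phi> \<psi>)#})"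
| Box: "v \<notin> labels (\<Gamma> + {#Lab w (Box \<phi>)#}) \<Longrightarrow> G3Ldm (\<Gamma> + {#Rel Settled w v, Lab v \<phi>#})
    \<Longrightarrow> G3Ldm (\<Gamma> + {#Lab w (Box \<phi>)#})"
| Dia: "G3Ldm (\<Gamma> + {#Rel Settled w u, Lab w (Dia \<phi>), Lab u \<phi>#})
    \<Longrightarrow> G3Ldm (\<Gamma> + {#Rel Settled w u, Lab w (Dia \<phi>)#})"
| Stit: "v \<notin> labels (\<Gamma> + {#Lab w (Stit i \<phi>)#}) \<Longrightarrow> G3Ldm (\<Gamma> + {#Rel (Agent i) w v, Lab v \<phi>#})
    \<Longrightarrow> G3Ldm (\<Gamma> + {#Lab w (Stit i \<phi>)#})"
| CoStit: "G3Ldm (\<Gamma> + {#Rel (Agent i) w u, Lab w (CoStit i \<phi>), Lab u \<phi>#})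
    \<Longrightarrow> G3Ldm (\<Gamma> + {#Rel (Agent i) w u, Lab w (CoStit i \<phi>)#})"
| refl_Box: "G3Ldm ({#Rel Settled w w#} + \<Gamma>) \<Longrightarrow> G3Ldm \<Gamma>"
| refl_Agent: "G3Ldm ({#Rel (Agent i) w w#} + \<Gamma>) \<Longrightarrow> G3Ldm \<Gamma>"
| IOA: "v \<notin> labels (image_mset (\<lambda>i::'ag. Rel Settled w (u i)) (mset_set UNIV) + \<Gamma>)
    \<Longrightarrow> G3Ldm (image_mset (\<lambda>i. Rel Settled w (u i)) (mset_set UNIV)
          + image_mset (\<lambda>i. Rel (Agent i) (u i) v) (mset_set UNIV) + \<Gamma>)
    \<Longrightarrow> G3Ldm (image_mset (\<lambda>i. Rel Settled w (u i)) (mset_set UNIV) + \<Gamma>)"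
| IOA_ctr: "v \<notin> labels (mset_set (range (\<lambda>i::'ag. Rel Settled w (u i))) + \<Gamma>)
    \<Longrightarrow> G3Ldm (mset_set (range (\<lambda>i. Rel Settled w (u i)))
          + image_mset (\<lambda>i. Rel (Agent i) (u i) v) (mset_set UNIV) + \<Gamma>)
    \<Longrightarrow> G3Ldm (mset_set (range (\<lambda>i. Rel Settled w (u i))) + \<Gamma>)"
| eucl_Box: "G3Ldm ({#Rel Settled w u, Rel Settled w v, Rel Settled u v#} + \<Gamma>)
    \<Longrightarrow> G3Ldm ({#Rel Settled w u, Rel Settled w v#} + \<Gamma>)"
| eucl_Box_ctr: "G3Ldm ({#Rel Settled w u, Rel Settled u u#} + \<Gamma>)
    \<Longrightarrow> G3Ldm ({#Rel Settled w u#} + \<Gamma>)"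
| br_Agent: "G3Ldm ({#Rel Settled w u, Rel (Agent i) w u#} + \<Gamma>)
    \<Longrightarrow> G3Ldm ({#Rel (Agent i) w u#} + \<Gamma>)"
| eucl_Agent: "G3Ldm ({#Rel (Agent i) w u, Rel (Agent i) w v, Rel (Agent i) u v#} + \<Gamma>)
    \<Longrightarrow> G3Ldm ({#Rel (Agent i) w u, Rel (Agent i) w v#} + \<Gamma>)"
| eucl_Agent_ctr: "G3Ldm ({#Rel (Agent i) w u, Rel (Agent i) u u#} + \<Gamma>)
    \<Longrightarrow> G3Ldm ({#Rel (Agent i) w u#} + \<Gamma>)"

end

theory Submission
  imports Defs
begin

text \<open>If \<open>x : \<phi>\<close> is not derivable, applying the rules upwards in a fair order yields an infinite
  chain of underivable sequents. The relational atoms and formulas occurring in the chain form a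
  saturated set \<open>A\<close>, whose labels carry equivalence relations satisfying the atemporal conditions
  and on which all labelled formulas of \<open>A\<close> can be falsified. This atemporal model becomes a
  temporal one by letting each world \<open>x\<close> start a private timeline \<open>(x, 0), (x, 1), \<dots>\<close> along which,
  from time 1 on, every modal relation is the identity; no-choice between undivided histories
  (\<open>C6\<close>) then holds trivially.\<close>

section \<open>From atemporal to temporal models\<close>

text \<open>Equal times keep the lifted relations disjoint from \<open>timeline\<close>, as
  \<open>C7\<close> demands. Collapsing them to the identity at positive times serves
  \<open>C6\<close>, since every \<open>timeline\<close>-successor has positive time.\<close>

definition initial :: "'l rel \<Rightarrow> ('l \<times> nat) rel" where
  "initial r = {((x, m), (y, n)). m = n \<and> (if m = 0 then (x, y) \<in> r else x = y)}"

lemma initial_iff: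
  "(p, q) \<in> initial r \<longleftrightarrow>
    snd p = snd q \<and> (if snd p = 0 then (fst p, fst q) \<in> r else fst p = fst q)"
  by (cases p; cases q) (simp add: initial_def)

definition timeline :: "('l \<times> nat) rel" where
  "timeline = {((x, m), (y, n)). x = y \<and> m < n}"

text \<open>The map \<open>e\<close> places the worlds in an arbitrary type \<open>'w\<close>,
  because validity refers to models over one given type. The valuation matters at time 0 only, which
  the modal relations never leave.\<close>

definition unravel ::
    "('l \<times> nat \<Rightarrow> 'w) \<Rightarrow> 'l rel \<Rightarrow> ('ag \<Rightarrow> 'l rel) \<Rightarrow> ('p \<Rightarrow> 'l set) \<Rightarrow> ('w, 'p, 'ag) frame" where
  "unravel e B R V =
    \<lparr>worlds = range e,
     RBox = map_prod e e ` initial B,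
     RAgt = (\<lambda>i. map_prod e e ` initial (R i)),
     RAg = map_prod e e ` initial (\<Inter>i. R i),
     RG = map_prod e e ` timeline,
     RH = (map_prod e e ` timeline)\<inverse>,
     Val = (\<lambda>p. e ` (V p \<times> {0}))\<rparr>"

lemma unravel_sel:
  "worlds (unravel e B R V) = range e"
  "RBox (unravel e B R V) = map_prod e e ` initial B"
  "RAgt (unravel e B R V) i = map_prod e e ` initial (R i)"
  "RAg (unravel e B R V) = map_prod e e ` initial (\<Inter>i. R i)"
  "RG (unravel e B R V) = map_prod e e ` timeline"
  "RH (unravel e B R V) = (map_prod e e ` timeline)\<inverse>"
  "Val (unravel e B R V) p = e ` (V p \<times> {0})"
  by (simp_all add: unravel_def)

section \<open>Transport of relations along an injection, and the lifted equivalences\<close>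

lemma map_prod_rel_iff [simp]:
  "inj e \<Longrightarrow> (e p, e q) \<in> map_prod e e ` r \<longleftrightarrow> (p, q) \<in> r"
  by (auto simp: inj_eq intro: rev_image_eqI)

lemma map_prod_rel_E:
  assumes "(a, b) \<in> map_prod e e ` r"
  obtains p q where "a = e p" "b = e q" "(p, q) \<in> r"
  using assms by auto

lemma Image_map_prod_rel: "inj e \<Longrightarrow> (map_prod e e ` r) `` {e p} = e ` (r `` {p})"
  by (auto simp: inj_eq)

lemma equiv_map_prod_rel:
  assumes "inj e" "equiv UNIV r"
  shows "equiv (range e) (map_prod e e ` r)"
proof (rule equivI)
  show "map_prod e e ` r \<subseteq> range e \<times> range e" by auto
  show "refl_on (range e) (map_prod e e ` r)"
    using assms by (auto simp: equiv_def intro!: refl_onI dest: refl_onD)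
  show "sym (map_prod e e ` r)"
    using assms by (auto simp: equiv_def intro!: symI dest: symD)
  show "trans (map_prod e e ` r)"
  proof (rule transI)
    fix a b c assume "(a, b) \<in> map_prod e e ` r" "(b, c) \<in> map_prod e e ` r"
    then obtain p q s where "a = e p" "c = e s" "(p, q) \<in> r" "(q, s) \<in> r"
      using \<open>inj e\<close> by (auto simp: inj_eq)
    then show "(a, c) \<in> map_prod e e ` r"
      using assms by (auto simp: equiv_def dest: transD)
  qed
qed

lemma equiv_initial:
  assumes "equiv UNIV r"
  shows "equiv UNIV (initial r)"
proof (rule equivI)
  show "refl (initial r)"
    using assms by (auto simp: equiv_def initial_def intro!: refl_onI dest: refl_onD)
  show "sym (initial r)"
    using assms by (auto simp: equiv_def initial_def intro!: symI dest: symD split: if_splits)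
  show "trans (initial r)"
    using assms by (auto simp: equiv_def initial_def intro!: transI dest: transD split: if_splits)
qed simp

lemma initial_self: "equiv UNIV r \<Longrightarrow> (p, p) \<in> initial r"
  using equiv_initial by (metis UNIV_I equiv_def refl_onD)

text \<open>Hypothesis \<open>indep\<close> is independence of agents for the atemporal structure
  and yields \<open>C2\<close> at time 0. The conditions on time hold because each timeline is a
  copy of the natural numbers and no two timelines meet.\<close>

lemma tstit_model_unravel:
  fixes e :: "'l \<times> nat \<Rightarrow> 'w" and R :: "'ag::finite \<Rightarrow> 'l rel" and V :: "'p::countable \<Rightarrow> 'l set"
  assumes e: "inj e"
    and B: "equiv UNIV B" and R: "\<And>i. equiv UNIV (R i)" and sub: "\<And>i. R i \<subseteq> B"
    and indep: "\<And>u. (\<And>i j. (u i, u j) \<in> B) \<Longrightarrow> \<exists>v. \<forall>i. (u i, v) \<in> R i"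
  shows "tstit_model (unravel e B R V)"
proof -
  have Ag: "equiv UNIV (\<Inter>i. R i)"
  proof (rule equivI)
    show "refl (\<Inter>i. R i)"
      using R by (intro refl_onI) (simp_all add: equiv_class_self[of UNIV, simplified])
    show "sym (\<Inter>i. R i)"
    proof (rule symI)
      fix x y assume "(x, y) \<in> (\<Inter>i. R i)"
      then show "(y, x) \<in> (\<Inter>i. R i)"
        using R by (simp add: equiv_def) (meson symD)
    qed
    show "trans (\<Inter>i. R i)"
    proof (rule transI)
      fix x y z assume "(x, y) \<in> (\<Inter>i. R i)" "(y, z) \<in> (\<Inter>i. R i)"
      then show "(x, z) \<in> (\<Inter>i. R i)"
        using R by (simp add: equiv_def) (meson transD)
    qed
  qed simp
  have C2: "(\<Inter>i. (map_prod e e ` initial (R i)) `` {u i}) \<noteq> {}"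
    if u: "\<And>i. u i \<in> range e" "\<And>i j. (u i, u j) \<in> map_prod e e ` initial B" for u
  proof -
    define f where "f i = inv e (u i)" for i
    have f: "u i = e (f i)" for i
      using u(1)[of i] by (simp add: f_def f_inv_into_f)
    have rel: "(f i, f j) \<in> initial B" for i j
      using u(2)[of i j] e by (simp add: f)
    \<comment> \<open>All \<open>f i\<close> share one time, so it can be read off at an arbitrary
      agent.\<close>
    define n where "n = snd (f undefined)"
    have n: "snd (f i) = n" for i
      using rel[of i undefined] by (simp add: n_def initial_iff)
    show ?thesis
    proof (cases "n = 0")
      case True
      have "(fst (f i), fst (f j)) \<in> B" for i j
        using rel[of i j] n[of i] True by (simp add: initial_iff)
      then obtain v where v: "\<And>i. (fst (f i), v) \<in> R i"
        using indep[of "\<lambda>i. fst (f i)"] by blast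
      have "(f i, (v, 0)) \<in> initial (R i)" for i
        using v[of i] n[of i] True by (simp add: initial_iff)
      then have "e (v, 0) \<in> (\<Inter>i. (map_prod e e ` initial (R i)) `` {u i})"
        using e by (simp add: f Image_iff)
      then show ?thesis by blast
    next
      case False
      obtain q where q: "q = f undefined" by blast
      \<comment> \<open>At a positive time \<open>initial B\<close> is equality, so all chosen
        worlds coincide and their common value is itself the witness.\<close>
      have "f i = q" for i
        using rel[of i undefined] n[of i] False unfolding q
        by (simp add: initial_iff prod_eq_iff)
      then have "e q \<in> (\<Inter>i. (map_prod e e ` initial (R i)) `` {u i})"
        using e initial_self[OF R] by (simp add: f Image_iff)
      then show ?thesis by blast
    qed
  qed
  have C6: "(map_prod e e ` timeline) O (map_prod e e ` initial B)
    \<subseteq> (map_prod e e ` initial (\<Inter>i. R i)) O (map_prod e e ` timeline)"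
  proof (rule subrelI)
    fix a c assume "(a, c) \<in> (map_prod e e ` timeline) O (map_prod e e ` initial B)"
    then obtain b where "(a, b) \<in> map_prod e e ` timeline" "(b, c) \<in> map_prod e e ` initial B"
      by (rule relcompEpair)
    then obtain p q r where pqr: "a = e p" "c = e r" "(p, q) \<in> timeline" "(q, r) \<in> initial B"
      using e by (elim map_prod_rel_E) (auto simp: inj_eq)
    \<comment> \<open>The time of \<open>q\<close> is positive, hence \<open>q = r\<close>. So
      \<open>C6\<close> needs only a trivial first step from \<open>p\<close> to itself.\<close>
    then have "(p, r) \<in> timeline"
      by (auto simp: timeline_def initial_def)
    moreover have "(p, p) \<in> initial (\<Inter>i. R i)"
      by (rule initial_self[OF Ag])
    ultimately show
      "(a, c) \<in> (map_prod e e ` initial (\<Inter>i. R i)) O (map_prod e e ` timeline)"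
      using e by (intro relcompI[of _ "e p"]) (simp_all add: pqr)
  qed
  show ?thesis
  proof (unfold_locales, unfold unravel_sel)
    show "(\<Inter>i. (map_prod e e ` initial (R i)) `` {u i}) \<noteq> {}"
      if "\<And>i. u i \<in> range e" "\<And>i j. (u i, u j) \<in> map_prod e e ` initial B" for u
      using that by (rule C2)
    show "(map_prod e e ` timeline) O (map_prod e e ` initial B)
      \<subseteq> (map_prod e e ` initial (\<Inter>i. R i)) O (map_prod e e ` timeline)"
      by (rule C6)
    show "equiv (range e) (map_prod e e ` initial B)"
      "\<And>i. equiv (range e) (map_prod e e ` initial (R i))"
      "equiv (range e) (map_prod e e ` initial (\<Inter>i. R i))"
      using e B R Ag by (auto intro!: equiv_map_prod_rel equiv_initial)
    show "map_prod e e ` initial (R i) \<subseteq> map_prod e e ` initial B" for i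
      using subsetD[OF sub[of i]] by (intro image_mono) (auto simp: initial_def)
    show "(map_prod e e ` initial (\<Inter>i. R i)) `` {w}
      = (\<Inter>i. (map_prod e e ` initial (R i)) `` {w})" if "w \<in> range e" for w
    proof -
      obtain p where p: "w = e p" using \<open>w \<in> range e\<close> by auto
      have "initial (\<Inter>i. R i) `` {p} = (\<Inter>i. initial (R i) `` {p})"
        by (auto simp: initial_def)
      \<comment> \<open>Images under the injective \<open>e\<close> commute with intersections over
        a nonempty index set; \<open>j = undefined\<close> supplies an index.\<close>
      then show ?thesis
        unfolding p Image_map_prod_rel[OF e] by (simp add: image_INT[OF e, where j = undefined])
    qed
    show "trans (map_prod e e ` timeline)"
    proof (rule transI)
      fix a b c assume "(a, b) \<in> map_prod e e ` timeline" "(b, c) \<in> map_prod e e ` timeline"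
      then obtain p q r where "a = e p" "c = e r" "(p, q) \<in> timeline" "(q, r) \<in> timeline"
        using e by (elim map_prod_rel_E) (auto simp: inj_eq)
      moreover from this have "(p, r) \<in> timeline"
        by (auto simp: timeline_def)
      ultimately show "(a, c) \<in> map_prod e e ` timeline"
        using e by simp
    qed
    show "\<exists>v. (w, v) \<in> map_prod e e ` timeline" if w: "w \<in> range e" for w
    proof -
      obtain x n where "w = e (x, n)" using w by auto
      moreover have "((x, n), (x, Suc n)) \<in> timeline" by (simp add: timeline_def)
      ultimately show ?thesis using e map_prod_rel_iff by metis
    qed
    show "(u, v) \<in> map_prod e e ` timeline \<or> u = v \<or> (v, u) \<in> map_prod e e ` timeline"
      if uv: "(w, u) \<in> map_prod e e ` timeline" "(w, v) \<in> map_prod e e ` timeline" for w u v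
    proof -
      obtain p q r where "u = e q" "v = e r" "(p, q) \<in> timeline" "(p, r) \<in> timeline"
        using uv e by (elim map_prod_rel_E) (auto simp: inj_eq)
      moreover from this have "(q, r) \<in> timeline \<or> q = r \<or> (r, q) \<in> timeline"
        by (auto simp: timeline_def)
      ultimately show ?thesis using e by auto
    qed
    show "(u, v) \<in> (map_prod e e ` timeline)\<inverse> \<or> u = v \<or> (v, u) \<in> (map_prod e e ` timeline)\<inverse>"
      if uv: "(w, u) \<in> (map_prod e e ` timeline)\<inverse>" "(w, v) \<in> (map_prod e e ` timeline)\<inverse>"
      for w u v
    proof -
      obtain p q r where "u = e q" "v = e r" "(q, p) \<in> timeline" "(r, p) \<in> timeline"
        using uv e unfolding converse_iff by (elim map_prod_rel_E) (auto simp: inj_eq)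
      moreover from this have "(q, r) \<in> timeline \<or> q = r \<or> (r, q) \<in> timeline"
        by (auto simp: timeline_def)
      ultimately show ?thesis using e by auto
    qed
    show "u \<notin> (map_prod e e ` timeline) `` {w}" if u: "u \<in> (map_prod e e ` initial B) `` {w}" for w u
    proof -
      obtain p q where "w = e p" "u = e q" "(p, q) \<in> initial B"
        using u by (auto elim: map_prod_rel_E)
      moreover from this have "(p, q) \<notin> timeline"
        by (auto simp: timeline_def initial_def)
      ultimately show ?thesis using e by simp
    qed
    show "range e \<noteq> {}" by simp
    show "e ` (V p \<times> {0}) \<subseteq> range e" for p by auto
    show "map_prod e e ` timeline \<subseteq> range e \<times> range e" by auto
    show "(map_prod e e ` timeline)\<inverse> = (map_prod e e ` timeline)\<inverse>" by (rule refl)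
  qed
qed

text \<open>The worlds at time 0 form a copy of the atemporal structure closed under the modal
  relations, so formulas without temporal operators can be evaluated inside it.\<close>

lemma unravel_simps:
  fixes e :: "'l \<times> nat \<Rightarrow> 'w"
  assumes "inj e"
  shows "e (x, 0) \<in> Val (unravel e B R V) p \<longleftrightarrow> x \<in> V p"
    and "RBox (unravel e B R V) `` {e (x, 0)} = (\<lambda>y. e (y, 0)) ` (B `` {x})"
    and "RAgt (unravel e B R V) i `` {e (x, 0)} = (\<lambda>y. e (y, 0)) ` (R i `` {x})"
proof -
  show "e (x, 0) \<in> Val (unravel e B R V) p \<longleftrightarrow> x \<in> V p"
    by (simp add: unravel_sel inj_image_mem_iff[OF assms])
  have "initial r `` {(x, 0)} = (\<lambda>y. (y, 0)) ` (r `` {x})" for r :: "'l rel"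
    by (auto simp: initial_def)
  then show "RBox (unravel e B R V) `` {e (x, 0)} = (\<lambda>y. e (y, 0)) ` (B `` {x})"
    and "RAgt (unravel e B R V) i `` {e (x, 0)} = (\<lambda>y. e (y, 0)) ` (R i `` {x})"
    by (simp_all add: unravel_sel Image_map_prod_rel[OF assms] image_image)
qed

section \<open>Saturation\<close>

instance fml :: (countable, countable) countable
  by countable_datatype

instance index :: (countable) countable
  by countable_datatype

text \<open>A task is an instance of a rule read upwards. The function \<open>u\<close> of an instance of \<open>IOA\<close>
  is coded as a natural number, so that tasks form a first-order, hence countable, datatype.\<close>

datatype ('p, 'ag) task =
    TClash label 'p
  | TAnd label "('p, 'ag) fml" "('p, 'ag) fml"
  | TOr label "('p, 'ag) fml" "('p, 'ag) fml"
  | TBox label "('p, 'ag) fml"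
  | TDia label label "('p, 'ag) fml"
  | TStit 'ag label "('p, 'ag) fml"
  | TCoStit 'ag label label "('p, 'ag) fml"
  | TRefl "'ag index" label
  | TEucl "'ag index" label label label
  | TBr 'ag label label
  | TIOA label nat

instance task :: (countable, countable) countable
  by countable_datatype

text \<open>The active items of the rule's conclusion. Being a set, it counts coinciding relational
  atoms once; the contracted rules cover these cases.\<close>

fun required :: "('p, 'ag::finite) task \<Rightarrow> ('p, 'ag) item set" where
  "required (TClash w p) = {Lab w (Pos p), Lab w (Neg p)}"
| "required (TAnd w \<phi> \<psi>) = {Lab w (And \<phi> \<psi>)}"
| "required (TOr w \<phi> \<psi>) = {Lab w (Or \<phi> \<psi>)}"
| "required (TBox w \<phi>) = {Lab w (Box \<phi>)}"
| "required (TDia w u \<phi>) = {Rel Settled w u, Lab w (Dia \<phi>)}"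
| "required (TStit i w \<phi>) = {Lab w (Stit i \<phi>)}"
| "required (TCoStit i w u \<phi>) = {Rel (Agent i) w u, Lab w (CoStit i \<phi>)}"
| "required (TRefl \<alpha> w) = {}"
| "required (TEucl \<alpha> w u v) = {Rel \<alpha> w u, Rel \<alpha> w v}"
| "required (TBr i w u) = {Rel (Agent i) w u}"
| "required (TIOA w k) = range (\<lambda>i. Rel Settled w ((from_nat k :: 'ag \<Rightarrow> label) i))"

text \<open>These principal formulas are not repeated in the premises, so the chain of sequents is
  not increasing and persistence of items has to be argued.\<close>

fun consumed :: "('p, 'ag) task \<Rightarrow> ('p, 'ag) item set" where
  "consumed (TAnd w \<phi> \<psi>) = {Lab w (And \<phi> \<psi>)}"
| "consumed (TOr w \<phi> \<psi>) = {Lab w (Or \<phi> \<psi>)}"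
| "consumed (TBox w \<phi>) = {Lab w (Box \<phi>)}"
| "consumed (TStit i w \<phi>) = {Lab w (Stit i \<phi>)}"
| "consumed _ = {}"

text \<open>What the chosen premise contributes. \<open>TClash\<close> can never be achieved,
  because its required items make the sequent an axiom. Freshness of \<open>v\<close> is forgotten:
  for the countermodel its existence suffices.\<close>

fun achieved :: "('p, 'ag::finite) task \<Rightarrow> ('p, 'ag) item set \<Rightarrow> bool" where
  "achieved (TClash w p) X \<longleftrightarrow> False"
| "achieved (TAnd w \<phi> \<psi>) X \<longleftrightarrow> Lab w \<phi> \<in> X \<or> Lab w \<psi> \<in> X"
| "achieved (TOr w \<phi> \<psi>) X \<longleftrightarrow> Lab w \<phi> \<in> X \<and> Lab w \<psi> \<in> X"
| "achieved (TBox w \<phi>) X \<longleftrightarrow> (\<exists>v. Rel Settled w v \<in> X \<and> Lab v \<phi> \<in> X)"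
| "achieved (TDia w u \<phi>) X \<longleftrightarrow> Lab u \<phi> \<in> X"
| "achieved (TStit i w \<phi>) X \<longleftrightarrow> (\<exists>v. Rel (Agent i) w v \<in> X \<and> Lab v \<phi> \<in> X)"
| "achieved (TCoStit i w u \<phi>) X \<longleftrightarrow> Lab u \<phi> \<in> X"
| "achieved (TRefl \<alpha> w) X \<longleftrightarrow> Rel \<alpha> w w \<in> X"
| "achieved (TEucl \<alpha> w u v) X \<longleftrightarrow> Rel \<alpha> u v \<in> X"
| "achieved (TBr i w u) X \<longleftrightarrow> Rel Settled w u \<in> X"
| "achieved (TIOA w k) X \<longleftrightarrow> (\<exists>v. \<forall>i. Rel (Agent i) ((from_nat k :: 'ag \<Rightarrow> label) i) v \<in> X)"

section \<open>Bookkeeping of tasks\<close>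

lemma achieved_mono: "achieved t X \<Longrightarrow> X \<subseteq> Y \<Longrightarrow> achieved t Y"
  by (cases t; simp; blast)

text \<open>A compound formula of one of the four consumable shapes determines the only task that
  requires it. Hence it can disappear only when that task is carried out.\<close>

lemma consumed_required_eq: "a \<in> consumed t \<Longrightarrow> a \<in> required t' \<Longrightarrow> t = t'"
  by (cases t; cases t') auto

text \<open>A perishable item therefore never has to wait for a second item to appear at the same
  stage.\<close>

lemma required_subset_consumed: "consumed t \<noteq> {} \<Longrightarrow> \<exists>a. required t = {a}"
  by (cases t) auto

lemma finite_required: "finite (required t)"
  by (cases t) auto

section \<open>One rule read upwards\<close>

lemma ex_fresh_label: "\<exists>v. v \<notin> labels \<Gamma>"
proof -
  have "finite (item_labels a)" for a :: "('p, 'ag) item"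
    by (cases a) auto
  then have "finite (labels \<Gamma>)"
    by (auto simp: labels_def)
  then show ?thesis
    using ex_new_if_finite infinite_UNIV_nat by blast
qed

lemma two_members_mset:
  assumes "a \<in># \<Gamma>" "b \<in># \<Gamma>" "a \<noteq> b"
  obtains \<Delta> where "\<Gamma> = \<Delta> + {#a, b#}"
  using assms by (metis add_mset_add_single insert_noteq_member multi_member_split union_mset_add_mset_right)

text \<open>By contraposition of the rule, an underivable conclusion has an underivable premise,
  which becomes \<open>\<Gamma>'\<close>. If the rule does not apply, \<open>\<Gamma>\<close> itself
  serves.\<close>

lemma reduction_step:
  fixes t :: "('p, 'ag::finite) task"
  assumes nd: "\<not> G3Ldm \<Gamma>"
  shows "\<exists>\<Gamma>'. \<not> G3Ldm \<Gamma>' \<and> set_mset \<Gamma> - consumed t \<subseteq> set_mset \<Gamma>'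
    \<and> (required t \<subseteq> set_mset \<Gamma> \<longrightarrow> achieved t (set_mset \<Gamma>'))"
proof (cases "required t \<subseteq> set_mset \<Gamma>")
  case False
  then show ?thesis using nd by blast
next
  case req: True
  show ?thesis
  proof (cases t)
    case (TClash w p)
    then obtain \<Delta> where "\<Gamma> = \<Delta> + {#Lab w (Pos p), Lab w (Neg p)#}"
      using req by (auto elim: two_members_mset)
    then show ?thesis using nd G3Ldm.id[of \<Delta> w p] by blast
  next
    case (TAnd w \<phi> \<psi>)
    then obtain \<Delta> where \<Delta>: "\<Gamma> = \<Delta> + {#Lab w (And \<phi> \<psi>)#}"
      using req by (auto dest: multi_member_split)
    then have "\<not> G3Ldm (\<Delta> + {#Lab w \<phi>#}) \<or> \<not> G3Ldm (\<Delta> + {#Lab w \<psi>#})"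
      using nd G3Ldm.And[of \<Delta> w \<phi> \<psi>] unfolding \<Delta> by blast
    then show ?thesis
    proof
      assume "\<not> G3Ldm (\<Delta> + {#Lab w \<phi>#})"
      then show ?thesis
        by (intro exI conjI, assumption) (auto simp: TAnd \<Delta>)
    next
      assume "\<not> G3Ldm (\<Delta> + {#Lab w \<psi>#})"
      then show ?thesis
        by (intro exI conjI, assumption) (auto simp: TAnd \<Delta>)
    qed
  next
    case (TOr w \<phi> \<psi>)
    then obtain \<Delta> where \<Delta>: "\<Gamma> = \<Delta> + {#Lab w (Or \<phi> \<psi>)#}"
      using req by (auto dest: multi_member_split)
    then have "\<not> G3Ldm (\<Delta> + {#Lab w \<phi>, Lab w \<psi>#})"
      using nd G3Ldm.Or[of \<Delta> w \<phi> \<psi>] unfolding \<Delta> by blast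
    then show ?thesis
      by (intro exI conjI, assumption) (auto simp: TOr \<Delta>)
  next
    case (TBox w \<phi>)
    then obtain \<Delta> where \<Delta>: "\<Gamma> = \<Delta> + {#Lab w (Box \<phi>)#}"
      using req by (auto dest: multi_member_split)
    obtain v where "v \<notin> labels \<Gamma>"
      using ex_fresh_label by blast
    then have "\<not> G3Ldm (\<Delta> + {#Rel Settled w v, Lab v \<phi>#})"
      using nd G3Ldm.Box[of v \<Delta> w \<phi>] unfolding \<Delta> by blast
    then show ?thesis
      by (intro exI conjI, assumption) (auto simp: TBox \<Delta>)
  next
    case (TDia w u \<phi>)
    then obtain \<Delta> where \<Delta>: "\<Gamma> = \<Delta> + {#Rel Settled w u, Lab w (Dia \<phi>)#}"
      using req by (auto elim: two_members_mset)
    then have "\<not> G3Ldm (\<Delta> + {#Rel Settled w u, Lab w (Dia \<phi>), Lab u \<phi>#})"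
      using nd G3Ldm.Dia[of \<Delta> w u \<phi>] unfolding \<Delta> by blast
    then show ?thesis
      by (intro exI conjI, assumption) (auto simp: TDia \<Delta>)
  next
    case (TStit i w \<phi>)
    then obtain \<Delta> where \<Delta>: "\<Gamma> = \<Delta> + {#Lab w (Stit i \<phi>)#}"
      using req by (auto dest: multi_member_split)
    obtain v where "v \<notin> labels \<Gamma>"
      using ex_fresh_label by blast
    then have "\<not> G3Ldm (\<Delta> + {#Rel (Agent i) w v, Lab v \<phi>#})"
      using nd G3Ldm.Stit[of v \<Delta> w i \<phi>] unfolding \<Delta> by blast
    then show ?thesis
      by (intro exI conjI, assumption) (auto simp: TStit \<Delta>)
  next
    case (TCoStit i w u \<phi>)
    then obtain \<Delta> where \<Delta>: "\<Gamma> = \<Delta> + {#Rel (Agent i) w u, Lab w (CoStit i \<phi>)#}"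
      using req by (auto elim: two_members_mset)
    then have "\<not> G3Ldm (\<Delta> + {#Rel (Agent i) w u, Lab w (CoStit i \<phi>), Lab u \<phi>#})"
      using nd G3Ldm.CoStit[of \<Delta> i w u \<phi>] unfolding \<Delta> by blast
    then show ?thesis
      by (intro exI conjI, assumption) (auto simp: TCoStit \<Delta>)
  next
    case (TRefl \<alpha> w)
    have "\<not> G3Ldm ({#Rel \<alpha> w w#} + \<Gamma>)"
      using nd G3Ldm.refl_Box G3Ldm.refl_Agent by (cases \<alpha>) blast+
    then show ?thesis
      by (intro exI conjI, assumption) (auto simp: TRefl)
  next
    case (TEucl \<alpha> w u v)
    have "\<not> G3Ldm ({#Rel \<alpha> u v#} + \<Gamma>)"
    proof (cases "u = v")
      \<comment> \<open>The two active atoms coincide and \<open>\<Gamma>\<close> may hold a single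
        copy, so the contracted Euclidean rules are used.\<close>
      case True
      obtain \<Delta> where \<Delta>: "\<Gamma> = {#Rel \<alpha> w u#} + \<Delta>"
        using req TEucl by (auto dest: multi_member_split)
      show ?thesis
        using nd G3Ldm.eucl_Box_ctr[of w u \<Delta>] G3Ldm.eucl_Agent_ctr[of _ w u \<Delta>] True
        by (cases \<alpha>) (auto simp: \<Delta> add_mset_commute)
    next
      case False
      then obtain \<Delta> where "\<Gamma> = \<Delta> + {#Rel \<alpha> w u, Rel \<alpha> w v#}"
        using req TEucl by (auto elim: two_members_mset)
      then show ?thesis
        using nd G3Ldm.eucl_Box[of w u v \<Delta>] G3Ldm.eucl_Agent[of _ w u v \<Delta>]
        by (cases \<alpha>) (auto simp: add_mset_commute)
    qed
    then show ?thesis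
      by (intro exI conjI, assumption) (auto simp: TEucl)
  next
    case (TBr i w u)
    obtain \<Delta> where \<Delta>: "\<Gamma> = {#Rel (Agent i) w u#} + \<Delta>"
      using req TBr by (auto dest: multi_member_split)
    then have "\<not> G3Ldm ({#Rel Settled w u, Rel (Agent i) w u#} + \<Delta>)"
      using nd G3Ldm.br_Agent[of w u i \<Delta>] unfolding \<Delta> by blast
    then show ?thesis
      by (intro exI conjI, assumption) (auto simp: TBr \<Delta>)
  next
    case (TIOA w k)
    define u :: "'ag \<Rightarrow> label" where "u = from_nat k"
    \<comment> \<open>Only one copy of each atom is guaranteed, even if \<open>u\<close> is not
      injective; hence \<open>IOA_ctr\<close> is the applicable rule.\<close>
    have "mset_set (range (\<lambda>i. Rel Settled w (u i))) \<subseteq># \<Gamma>"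
      using req
      by (intro subset_mset.order_trans[OF subset_imp_msubset_mset_set mset_set_set_mset_msubset])
        (auto simp: TIOA u_def)
    then obtain \<Delta> where \<Delta>: "\<Gamma> = mset_set (range (\<lambda>i. Rel Settled w (u i))) + \<Delta>"
      by (auto simp: mset_subset_eq_exists_conv)
    obtain v where "v \<notin> labels \<Gamma>"
      using ex_fresh_label by blast
    then have "\<not> G3Ldm (mset_set (range (\<lambda>i. Rel Settled w (u i)))
        + image_mset (\<lambda>i. Rel (Agent i) (u i) v) (mset_set UNIV) + \<Delta>)"
      using nd G3Ldm.IOA_ctr[of v w u \<Delta>] unfolding \<Delta> by blast
    then show ?thesis
      by (intro exI conjI, assumption) (auto simp: TIOA \<Delta> u_def)
  qed
qed

text \<open>The set \<open>A\<close> is the union of a chain in which every task has its turn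
  infinitely often. Two things need care: items entering at different stages must meet at one stage,
  and they must survive until their task is due. Both follow from
  \<open>consumed_required_eq\<close>.\<close>

lemma saturated_extension:
  fixes \<Gamma> :: "('p::countable, 'ag::finite) sequent"
  assumes "\<not> G3Ldm \<Gamma>"
  obtains A where "set_mset \<Gamma> \<subseteq> A" "\<And>t. required t \<subseteq> A \<Longrightarrow> achieved t A"
proof -
  \<comment> \<open>The first component of the decoded pair is a dummy that makes each task recur
    beyond every bound.\<close>
  define T :: "nat \<Rightarrow> ('p, 'ag) task" where "T n = from_nat (snd (prod_decode n))" for n
  have fair: "\<exists>m\<ge>n. T m = t" for t n
    using le_prod_encode_1[of n "to_nat t"]
    by (intro exI[of _ "prod_encode (n, to_nat t)"]) (simp add: T_def)
  \<comment> \<open>The clause for \<open>n = 0\<close> pins the start of the chain to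
    \<open>\<Gamma>\<close>.\<close>
  have "\<exists>f. \<forall>n. (\<not> G3Ldm (f n) \<and> (n = 0 \<longrightarrow> f n = \<Gamma>)) \<and>
      (set_mset (f n) - consumed (T n) \<subseteq> set_mset (f (Suc n)) \<and>
       (required (T n) \<subseteq> set_mset (f n) \<longrightarrow> achieved (T n) (set_mset (f (Suc n)))))"
  proof (rule dependent_nat_choice)
    show "\<exists>\<Delta>. \<not> G3Ldm \<Delta> \<and> (0 = (0::nat) \<longrightarrow> \<Delta> = \<Gamma>)"
      using assms by blast
    show "\<exists>\<Delta>'. (\<not> G3Ldm \<Delta>' \<and> (Suc n = 0 \<longrightarrow> \<Delta>' = \<Gamma>)) \<and>
        (set_mset \<Delta> - consumed (T n) \<subseteq> set_mset \<Delta>' \<and>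
         (required (T n) \<subseteq> set_mset \<Delta> \<longrightarrow> achieved (T n) (set_mset \<Delta>')))"
      if "\<not> G3Ldm \<Delta> \<and> (n = 0 \<longrightarrow> \<Delta> = \<Gamma>)" for \<Delta> n
      using reduction_step[of \<Delta> "T n"] that by simp
  qed
  then obtain f where f0: "f 0 = \<Gamma>"
    and keep: "\<And>n. set_mset (f n) - consumed (T n) \<subseteq> set_mset (f (Suc n))"
    and achieve: "\<And>n. required (T n) \<subseteq> set_mset (f n) \<Longrightarrow> achieved (T n) (set_mset (f (Suc n)))"
    by metis
  define A where "A = (\<Union>n. set_mset (f n))"
  have persist: "a \<in># f m"
    if "n \<le> m" "a \<in># f n" "\<And>k. n \<le> k \<Longrightarrow> k < m \<Longrightarrow> a \<notin> consumed (T k)" for a n m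
    using that
  proof (induction m rule: dec_induct)
    case (step m)
    then have "a \<in># f m" "a \<notin> consumed (T m)"
      by simp_all
    then show ?case using keep[of m] by blast
  qed simp
  have together: "\<exists>n. required t \<subseteq> set_mset (f n)" if t: "required t \<subseteq> A" for t
  proof (cases "consumed t = {}")
    case False
    then obtain a where "required t = {a}"
      using required_subset_consumed by blast
    then show ?thesis using t by (auto simp: A_def)
  next
    case True
    \<comment> \<open>If some task consumed \<open>a\<close>, it would equal \<open>t\<close>, which
      consumes nothing. So the items of \<open>t\<close> stay for good and are all present once the
      last has entered.\<close>
    have never: "a \<notin> consumed (T k)" if "a \<in> required t" for a k
      using consumed_required_eq[OF _ that] True by blast
    have "\<forall>a \<in> required t. \<exists>n. a \<in># f n"
      using t by (auto simp: A_def)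
    then obtain g where g: "\<And>a. a \<in> required t \<Longrightarrow> a \<in># f (g a)"
      unfolding bchoice_iff by blast
    have "a \<in># f (Max (g ` required t))" if "a \<in> required t" for a
    proof (rule persist)
      show "g a \<le> Max (g ` required t)"
        using that finite_required[of t] by simp
    qed (use that g never in simp_all)
    then show ?thesis by blast
  qed
  have "achieved t A" if t: "required t \<subseteq> A" for t
  proof -
    obtain n where n: "required t \<subseteq> set_mset (f n)"
      using together[OF t] by blast
    \<comment> \<open>Before the first turn of \<open>t\<close> from stage \<open>n\<close> on, only
      other tasks act, and these cannot consume items that \<open>t\<close> requires.\<close>
    define m where "m = (LEAST m. n \<le> m \<and> T m = t)"
    have m: "n \<le> m" "T m = t"
      using LeastI_ex[of "\<lambda>m. n \<le> m \<and> T m = t"] fair unfolding m_def by auto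
    have least: "T k \<noteq> t" if "n \<le> k" "k < m" for k
      using not_less_Least[of k "\<lambda>m. n \<le> m \<and> T m = t"] that unfolding m_def by blast
    have "a \<in># f m" if "a \<in> required t" for a
    proof (rule persist[OF m(1)])
      show "a \<in># f n" using that n by blast
      show "a \<notin> consumed (T k)" if "n \<le> k" "k < m" for k
        using least[OF that] consumed_required_eq[OF _ \<open>a \<in> required t\<close>] by blast
    qed
    then have "achieved t (set_mset (f (Suc m)))"
      using achieve[of m] m(2) by blast
    then show ?thesis
      by (rule achieved_mono) (auto simp: A_def)
  qed
  moreover have "set_mset \<Gamma> \<subseteq> A"
    using f0 by (auto simp: A_def)
  ultimately show thesis using that by blast
qed

section \<open>Completeness\<close>

text \<open>Variable \<open>p\<close> is made true exactly where \<open>Neg p\<close> lies in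
  \<open>A\<close>; a positive literal of \<open>A\<close> is then false because
  \<open>TClash\<close> cannot be achieved. For diamonds, the successors at time 0 are exactly those
  given by atoms of \<open>A\<close>, and saturation puts the subformula at each of them.\<close>

lemma saturated_falsified:
  fixes A :: "('p, 'ag::finite) item set" and e :: "label \<times> nat \<Rightarrow> 'w"
  assumes sat: "\<And>t. required t \<subseteq> A \<Longrightarrow> achieved t A" and e: "inj e"
  defines "M \<equiv> unravel e {(x, y). Rel Settled x y \<in> A} (\<lambda>i. {(x, y). Rel (Agent i) x y \<in> A})
    (\<lambda>p. {x. Lab x (Neg p) \<in> A})"
  assumes "Lab x \<phi> \<in> A"
  shows "\<not> sat M (e (x, 0)) \<phi>"
  using \<open>Lab x \<phi> \<in> A\<close>
proof (induction \<phi> arbitrary: x)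
  case (Pos p)
  then show ?case using sat[of "TClash x p"] by (auto simp: M_def unravel_simps[OF e])
next
  case (Neg p)
  then show ?case by (auto simp: M_def unravel_simps[OF e])
next
  case (And \<phi> \<psi>)
  then show ?case using sat[of "TAnd x \<phi> \<psi>"] by auto
next
  case (Or \<phi> \<psi>)
  then show ?case using sat[of "TOr x \<phi> \<psi>"] by auto
next
  case (Box \<phi>)
  then show ?case
    using sat[of "TBox x \<phi>"] by (auto simp: M_def unravel_simps[OF e])
next
  case (Dia \<phi>)
  then show ?case
    using sat[of "TDia x _ \<phi>"] by (auto simp: M_def unravel_simps[OF e])
next
  case (Stit i \<phi>)
  then show ?case
    using sat[of "TStit i x \<phi>"] by (auto simp: M_def unravel_simps[OF e])
next
  case (CoStit i \<phi>)
  then show ?case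
    using sat[of "TCoStit i x _ \<phi>"] by (auto simp: M_def unravel_simps[OF e])
qed

text \<open>A reflexive Euclidean relation is an equivalence. \<open>TRefl\<close> requires nothing,
  so reflexivity covers all labels, including those not occurring in \<open>A\<close>.\<close>

lemma saturated_equiv:
  fixes A :: "('p, 'ag::finite) item set"
  assumes sat: "\<And>t. required t \<subseteq> A \<Longrightarrow> achieved t A"
  shows "equiv UNIV {(x, y). Rel \<alpha> x y \<in> A}"
proof -
  have refl: "Rel \<alpha> x x \<in> A" for x
    using sat[of "TRefl \<alpha> x"] by simp
  have eucl: "Rel \<alpha> y z \<in> A" if "Rel \<alpha> x y \<in> A" "Rel \<alpha> x z \<in> A" for x y z
    using sat[of "TEucl \<alpha> x y z"] that by simp
  have sym: "Rel \<alpha> y x \<in> A" if "Rel \<alpha> x y \<in> A" for x y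
    using eucl[OF that refl] .
  have trans: "Rel \<alpha> x z \<in> A" if "Rel \<alpha> x y \<in> A" "Rel \<alpha> y z \<in> A" for x y z
    using eucl[OF sym[OF that(1)] that(2)] .
  show ?thesis
    by (intro equivI refl_onI symI transI) (auto intro: refl sym trans)
qed

lemma saturated_model:
  fixes A :: "('p::countable, 'ag::finite) item set" and e :: "label \<times> nat \<Rightarrow> 'w"
  assumes sat: "\<And>t. required t \<subseteq> A \<Longrightarrow> achieved t A" and e: "inj e"
  shows "tstit_model (unravel e {(x, y). Rel Settled x y \<in> A}
    (\<lambda>i. {(x, y). Rel (Agent i) x y \<in> A}) (V :: 'p \<Rightarrow> label set))"
proof (rule tstit_model_unravel[OF e saturated_equiv[OF sat] saturated_equiv[OF sat]])
  show "{(x, y). Rel (Agent i) x y \<in> A} \<subseteq> {(x, y). Rel Settled x y \<in> A}" for i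
    using sat[of "TBr i _ _"] by auto
  show "\<exists>v. \<forall>i. (u i, v) \<in> {(x, y). Rel (Agent i) x y \<in> A}"
    if "\<And>i j. (u i, u j) \<in> {(x, y). Rel Settled x y \<in> A}" for u
    \<comment> \<open>Any one of the \<open>u i\<close> can serve as the root \<open>w\<close> of
      the rule, as they are pairwise related; \<open>to_nat u\<close> is the code of the whole
      choice.\<close>
    using sat[of "TIOA (u undefined) (to_nat u)"] that by auto
qed

theorem theorem4:
  fixes \<phi> :: "('p::countable, 'ag::finite) fml" and x :: label
  assumes "valid TYPE('w::infinite) \<phi>"
  shows "G3Ldm {#Lab x \<phi>#}"
proof (rule ccontr)
  assume "\<not> G3Ldm {#Lab x \<phi>#}"
  then obtain A where A: "Lab x \<phi> \<in> A" "\<And>t. required t \<subseteq> A \<Longrightarrow> achieved t A"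
    by (rule saturated_extension) auto
  \<comment> \<open>Infinity of \<open>'w\<close> is used here: it makes room for all pairs of a
    label and a time.\<close>
  obtain f :: "nat \<Rightarrow> 'w" where "inj f"
    using infinite_countable_subset[OF infinite_UNIV] by blast
  then have e: "inj (f \<circ> prod_encode)"
    by (simp add: inj_compose inj_prod_encode)
  let ?M = "unravel (f \<circ> prod_encode) {(x, y). Rel Settled x y \<in> A}
    (\<lambda>i. {(x, y). Rel (Agent i) x y \<in> A}) (\<lambda>p. {x. Lab x (Neg p) \<in> A})"
  have "globally_true ?M \<phi>"
    using assms saturated_model[OF A(2) e] unfolding valid_def by blast
  then have "sat ?M ((f \<circ> prod_encode) (x, 0)) \<phi>"
    unfolding globally_true_def by (auto simp: unravel_def)
  then show False
    using saturated_falsified[OF A(2) e A(1)] by blast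
qed

end
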